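(* The mechanism Random SDMT-2 (defined in the context) is universally truthful even if both the weights and the preference lists of the agents are their private knowledge, assuming that no agent can over-bid his weight. That is, for every fixed realisation of the random variables $(Y_j)_{j\in N}$, the resulting deterministic mechanism $\phi$ satisfies: for every weight vector $W=(w_j)_{j\in N}$, every preference profile $L$, every agent $i$, every reported weight $w_i'\le w_i$ and every reported list $L'(i)$, agent $i$ weakly prefers, according to $L(i)$, his outcome $\phi_i(W,L)$ to his outcome $\phi_i\big((w_i',w_{-i}),(L'(i),L(-i))\big)$.
   Context: House Allocation (HA). $N=\{1,\dots,n_1\}$ is a finite set of agents and $O=\{o_1,\dots,o_{n_2}\}$ a finite set of objects. Each agent $i$ has a preference list $L(i)=(C^i_1\succ_i C^i_2\succ_i\cdots)$, an ordered sequence of pairwise disjoint subsets of $O$ (indifference classes); objects in $C^i_k$ are strictly preferred to those in $C^i_l$ for $k<l$, and $i$ is indifferent between objects in the same class; if $C^i_l=\emptyset$ then $C^i_q=\emptyset$ for all $q\ge l$ and $C^i_{n_2+1}=\emptyset$. Objects in $\bigcup_k C^i_k$ are acceptable to $i$ (written $o\in L(i)$). $rank(i,o)=k$ if $o\in C^i_k$, and $n_2+1$ if $o$ is unacceptable or if $i$ is unmatched; $i$ prefers smaller rank. A matching is a set of (agent, acceptable object) pairs in which every agent and every object occurs at most once. Each agent $i$ has a weight $w_i>0$ (reported weights are also positive). A randomised mechanism is universally truthful if it is a probability distribution over deterministic truthful mechanisms. Trading graphs. During SDMT-2 agents are temporarily allocated sets of objects ("own" them), all objects owned by an agent lying in one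 of his indifference classes. An agent owning more than one object is called labelled, otherwise unlabelled. For an agent $i$, a set $S$ of agents with $i\notin S$, and $B\subseteq L(i)$, the trading graph $TG(i,B,S)$ is the directed graph on $\{i\}\cup S$ built as follows: $i$ points to each agent in $S$ owning an object of $B$; each unlabelled agent $j\in S$ that is pointed to, whose owned object lies in $C^j_k$, points to each agent in $S$ owning an object of $C^j_k$ not owned by $j$; this is repeated for newly pointed-to unlabelled agents until nothing changes. Labelled agents point to nobody. Write $TG(i,a,S)=TG(i,\{a\},S)$. Fix a common strict order on all objects (used only for tie-breaking). Let $H$ be the set of $a\in L(i)$ such that $TG(i,a,S)$ contains a directed path from $i$ to a labelled agent. If $H=\emptyset$, put $\max TG(i,L(i),S)=\emptyset$. Otherwise let $\ell$ be the smallest index with $H\cap C^i_\ell\ne\emptyset$; $\max TG(i,L(i),S)$ is the highest object of $H\cap C^i_\ell$ in the common order. $Trading(i,a,S)$: take a simple directed path $(i=i_0,i_1,\dots,i_k)$ in $TG(i,a,S)$ with only $i_k$ labelled (e.g. found by breadth-first search); for $s=0,\dots,k-1$ the object owned by $i_{s+1}$ is given to $i_s$, where $i_{k-1}$ receives the highest object in the common order among those owned by $i_k$ because of which $i_{k-1}$ points to $i_k$; afterwards $i_k$ remains labelled iff he still owns more than one object. SDMT-2, given an order of the agents: initially all objects are unallocated. Process agents in the given order. When agent $i$ is processed, let $O_i$ be the set of currently unallocated objects and $S$ the set of previously processed agents. Let $j_1$ be the smallest $j$ with $O_i\cap C^i_j\neq\emptyset$ ($j_1=n_2+1$ if none), and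 let $j_2$ be the index of the class $C^i_{j_2}$ containing $\max TG(i,L(i),S)$ ($j_2=n_2+1$ if $\max TG(i,L(i),S)=\emptyset$). If $j_1\le j_2$, allocate all objects of $O_i\cap C^i_{j_1}$ to $i$. Otherwise perform $Trading(i,\max TG(i,L(i),S),S)$. After all agents are processed, each labelled agent is matched to the highest object he owns in the common order, each unlabelled agent owning one object is matched to it, and all others are unmatched. Random SDMT-2: draw $Y_i$, $i\in N$, independently and uniformly from $[0,1]$; sort the agents in decreasing order of $w_i(1-e^{Y_i-1})$ (using reported weights), breaking ties in favour of the smaller index; run SDMT-2 (with reported lists) in this order and return its matching. *)

theory Defs
  imports "HOL-Probability.Probability"
begin

section \<open>House allocation with indifferences\<close>

text \<open>
  Agents are the numbers \<open>1, \<dots>, n1\<close>; the objects form a finite set \<open>Obj\<close> with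
  \<open>n2 = card Obj\<close>. A preference list \<open>C\<close> maps \<open>k \<ge> 1\<close> to the \<open>k\<close>-th indifference class;
  the index 0 is unused and carries the empty set.
\<close>

type_synonym 'o pref = "nat \<Rightarrow> 'o set"
type_synonym 'o profile = "nat \<Rightarrow> 'o pref"
type_synonym weights = "nat \<Rightarrow> real"
type_synonym 'o matching = "(nat \<times> 'o) set"

definition valid_pref :: "'o set \<Rightarrow> 'o pref \<Rightarrow> bool" where
  "valid_pref Obj C \<longleftrightarrow>
     C 0 = {} \<and>
     (\<forall>k. C k \<subseteq> Obj) \<and>
     (\<forall>k l. k \<noteq> l \<longrightarrow> C k \<inter> C l = {}) \<and>
     (\<forall>l\<ge>1. C l = {} \<longrightarrow> (\<forall>q\<ge>l. C q = {})) \<and>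
     C (card Obj + 1) = {}"

definition valid_profile :: "nat \<Rightarrow> 'o set \<Rightarrow> 'o profile \<Rightarrow> bool" where
  "valid_profile n1 Obj L \<longleftrightarrow> (\<forall>j\<in>{1..n1}. valid_pref Obj (L j))"

definition valid_weights :: "nat \<Rightarrow> weights \<Rightarrow> bool" where
  "valid_weights n1 W \<longleftrightarrow> (\<forall>j\<in>{1..n1}. W j > 0)"

definition acceptable :: "'o pref \<Rightarrow> 'o set" where
  "acceptable C = (\<Union>k. C k)"

definition pref_rank :: "'o set \<Rightarrow> 'o pref \<Rightarrow> 'o \<Rightarrow> nat" where
  "pref_rank Obj C x = (if x \<in> acceptable C then (THE k. x \<in> C k) else card Obj + 1)"

definition is_matching :: "nat \<Rightarrow> 'o profile \<Rightarrow> 'o matching \<Rightarrow> bool" where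
  "is_matching n1 L M \<longleftrightarrow>
     (\<forall>(j, x)\<in>M. j \<in> {1..n1} \<and> x \<in> acceptable (L j)) \<and>
     single_valued M \<and> single_valued (M\<inverse>)"

text \<open>The rank, with respect to the list \<open>C\<close>, of what agent \<open>i\<close> obtains in the matching \<open>M\<close>.\<close>

definition outcome_rank :: "'o set \<Rightarrow> 'o pref \<Rightarrow> 'o matching \<Rightarrow> nat \<Rightarrow> nat" where
  "outcome_rank Obj C M i =
     (if i \<in> Domain M then pref_rank Obj C (THE x. (i, x) \<in> M) else card Obj + 1)"


section \<open>Mechanisms\<close>

type_synonym 'o mechanism = "weights \<Rightarrow> 'o profile \<Rightarrow> 'o matching"

definition is_mechanism :: "nat \<Rightarrow> 'o set \<Rightarrow> 'o mechanism \<Rightarrow> bool" where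
  "is_mechanism n1 Obj \<phi> \<longleftrightarrow>
     (\<forall>W L. valid_weights n1 W \<longrightarrow> valid_profile n1 Obj L \<longrightarrow> is_matching n1 L (\<phi> W L))"

text \<open>Weights and lists are private; an agent may under-report but not over-report his weight.\<close>

definition truthful :: "nat \<Rightarrow> 'o set \<Rightarrow> 'o mechanism \<Rightarrow> bool" where
  "truthful n1 Obj \<phi> \<longleftrightarrow>
     (\<forall>W L i w' C'.
        valid_weights n1 W \<longrightarrow> valid_profile n1 Obj L \<longrightarrow> i \<in> {1..n1} \<longrightarrow>
        0 < w' \<longrightarrow> w' \<le> W i \<longrightarrow> valid_pref Obj C' \<longrightarrow>
        outcome_rank Obj (L i) (\<phi> W L) i
          \<le> outcome_rank Obj (L i) (\<phi> (W(i := w')) (L(i := C'))) i)"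

text \<open>
  A randomised mechanism is a family of deterministic mechanisms indexed by the points of a
  probability space, such that the matching returned for any given reports is a random variable.
\<close>

definition universally_truthful ::
    "nat \<Rightarrow> 'o set \<Rightarrow> 'w measure \<Rightarrow> ('w \<Rightarrow> 'o mechanism) \<Rightarrow> bool" where
  "universally_truthful n1 Obj P \<Phi> \<longleftrightarrow>
     prob_space P \<and>
     (\<forall>W L. valid_weights n1 W \<longrightarrow> valid_profile n1 Obj L \<longrightarrow>
        (\<lambda>\<omega>. \<Phi> \<omega> W L) \<in> P \<rightarrow>\<^sub>M count_space UNIV) \<and>
     (\<forall>\<omega>\<in>space P. is_mechanism n1 Obj (\<Phi> \<omega>) \<and> truthful n1 Obj (\<Phi> \<omega>))"


section \<open>Trading graphs\<close>

type_synonym 'o ownership = "nat \<Rightarrow> 'o set"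

definition labelled :: "'o ownership \<Rightarrow> nat \<Rightarrow> bool" where
  "labelled own j \<longleftrightarrow> card (own j) > 1"

text \<open>
  The objects because of which \<open>j\<close> points to their owners in the trading graph of \<open>i\<close> and \<open>B\<close>.
\<close>

definition wanted :: "'o profile \<Rightarrow> 'o ownership \<Rightarrow> nat \<Rightarrow> 'o set \<Rightarrow> nat \<Rightarrow> 'o set" where
  "wanted L own i B j =
     (if j = i then B else \<Union>{L j k | k. own j \<inter> L j k \<noteq> {}} - own j)"

inductive_set TG ::
    "'o profile \<Rightarrow> 'o ownership \<Rightarrow> nat \<Rightarrow> 'o set \<Rightarrow> nat set \<Rightarrow> (nat \<times> nat) set"
  for L own i B S where
  start: "j \<in> S \<Longrightarrow> own j \<inter> wanted L own i B i \<noteq> {} \<Longrightarrow> (i, j) \<in> TG L own i B S"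
| step: "(h, j) \<in> TG L own i B S \<Longrightarrow> \<not> labelled own j \<Longrightarrow>
         j' \<in> S \<Longrightarrow> own j' \<inter> wanted L own i B j \<noteq> {} \<Longrightarrow> (j, j') \<in> TG L own i B S"

text \<open>
  The common strict order on the objects is a relation \<open>R\<close>; \<open>(x, y) \<in> R\<close> means that \<open>y\<close> is
  higher than \<open>x\<close>.
\<close>

definition highest :: "'o rel \<Rightarrow> 'o set \<Rightarrow> 'o" where
  "highest R A = (THE x. x \<in> A \<and> (\<forall>y\<in>A. y \<noteq> x \<longrightarrow> (y, x) \<in> R))"

text \<open>The set called \<open>H\<close> in the definition of \<open>max TG(i, L(i), S)\<close>.\<close>

definition tradable :: "'o profile \<Rightarrow> 'o ownership \<Rightarrow> nat \<Rightarrow> nat set \<Rightarrow> 'o set" where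
  "tradable L own i S =
     {a \<in> acceptable (L i). \<exists>j. labelled own j \<and> (i, j) \<in> (TG L own i {a} S)\<^sup>+}"

definition max_TG ::
    "'o rel \<Rightarrow> 'o profile \<Rightarrow> 'o ownership \<Rightarrow> nat \<Rightarrow> nat set \<Rightarrow> 'o option" where
  "max_TG R L own i S =
     (let H = tradable L own i S in
      if H = {} then None
      else Some (highest R (H \<inter> L i (LEAST l. H \<inter> L i l \<noteq> {}))))"


section \<open>Trading\<close>

definition trading_path :: "'o ownership \<Rightarrow> (nat \<times> nat) set \<Rightarrow> nat \<Rightarrow> nat list \<Rightarrow> bool" where
  "trading_path own G i p \<longleftrightarrow>
     length p \<ge> 2 \<and> hd p = i \<and> distinct p \<and>
     (\<forall>s. Suc s < length p \<longrightarrow> (p ! s, p ! Suc s) \<in> G) \<and>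
     labelled own (last p) \<and> (\<forall>j\<in>set (butlast p). \<not> labelled own j)"

text \<open>
  The choice of the path is left open (breadth-first search is one possibility): it is made by an
  arbitrary fixed rule that, given the current ownership, a trading graph and its root, returns
  such a path whenever there is one.
\<close>

type_synonym 'o path_rule = "'o ownership \<Rightarrow> (nat \<times> nat) set \<Rightarrow> nat \<Rightarrow> nat list"

definition valid_path_rule :: "'o path_rule \<Rightarrow> bool" where
  "valid_path_rule pick \<longleftrightarrow>
     (\<forall>own G i. (\<exists>p. trading_path own G i p) \<longrightarrow> trading_path own G i (pick own G i))"

text \<open>
  All transfers along a path are simultaneous: every right-hand side refers to the ownership before
  the trade. The last agent gives away \<open>x\<close> only; each inner agent, being unlabelled, gives away
  the one object he owns.
\<close>

fun pass_along :: "nat list \<Rightarrow> 'o \<Rightarrow> 'o ownership \<Rightarrow> 'o ownership" where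
  "pass_along [j, j'] x own = own(j := {x}, j' := own j' - {x})"
| "pass_along (j # j' # j'' # js) x own = (pass_along (j' # j'' # js) x own)(j := own j')"
| "pass_along _ x own = own"

definition trading ::
    "'o rel \<Rightarrow> 'o path_rule \<Rightarrow> 'o profile \<Rightarrow> nat \<Rightarrow> 'o \<Rightarrow> nat set \<Rightarrow> 'o ownership \<Rightarrow> 'o ownership"
where
  "trading R pick L i a S own =
     (let p = pick own (TG L own i {a} S) i;
          x = highest R (own (last p) \<inter> wanted L own i {a} (last (butlast p)))
      in pass_along p x own)"


section \<open>SDMT-2\<close>

definition SDMT2_step ::
    "'o set \<Rightarrow> 'o rel \<Rightarrow> 'o path_rule \<Rightarrow> 'o profile \<Rightarrow> nat \<Rightarrow> nat set \<Rightarrow> 'o ownership \<Rightarrow> 'o ownership"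
where
  "SDMT2_step Obj R pick L i S own =
     (let Oi = Obj - (\<Union>j\<in>S. own j);
          j1 = (if Oi \<inter> acceptable (L i) \<noteq> {} then LEAST j. Oi \<inter> L i j \<noteq> {} else card Obj + 1);
          j2 = (case max_TG R L own i S of None \<Rightarrow> card Obj + 1 | Some a \<Rightarrow> pref_rank Obj (L i) a)
      in if j1 \<le> j2 then own(i := Oi \<inter> L i j1)
         else trading R pick L i (the (max_TG R L own i S)) S own)"

text \<open>The argument \<open>S\<close> is the set of agents processed so far.\<close>

fun SDMT2_run ::
    "'o set \<Rightarrow> 'o rel \<Rightarrow> 'o path_rule \<Rightarrow> 'o profile \<Rightarrow> nat list \<Rightarrow> nat set \<Rightarrow> 'o ownership \<Rightarrow> 'o ownership"
where
  "SDMT2_run Obj R pick L [] S own = own"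
| "SDMT2_run Obj R pick L (i # is) S own =
     SDMT2_run Obj R pick L is (insert i S) (SDMT2_step Obj R pick L i S own)"

text \<open>For an unlabelled agent with one object, \<open>highest\<close> returns that object.\<close>

definition SDMT2 ::
    "'o set \<Rightarrow> 'o rel \<Rightarrow> 'o path_rule \<Rightarrow> 'o profile \<Rightarrow> nat list \<Rightarrow> 'o matching" where
  "SDMT2 Obj R pick L agents =
     (let own = SDMT2_run Obj R pick L agents {} (\<lambda>_. {})
      in {(j, highest R (own j)) | j. j \<in> set agents \<and> own j \<noteq> {}})"


section \<open>Random SDMT-2\<close>

text \<open>
  Decreasing in \<open>w_i (1 - exp (Y_i - 1))\<close>. Since \<open>sort_key\<close> is stable and its argument is
  increasing, ties are broken in favour of the smaller index.
\<close>

definition agent_order :: "nat \<Rightarrow> (nat \<Rightarrow> real) \<Rightarrow> weights \<Rightarrow> nat list" where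
  "agent_order n1 Y W = sort_key (\<lambda>i. - (W i * (1 - exp (Y i - 1)))) [1..<n1 + 1]"

definition random_SDMT2 ::
    "nat \<Rightarrow> 'o set \<Rightarrow> 'o rel \<Rightarrow> 'o path_rule \<Rightarrow> (nat \<Rightarrow> real) \<Rightarrow> 'o mechanism" where
  "random_SDMT2 n1 Obj R pick Y W L = SDMT2 Obj R pick L (agent_order n1 Y W)"

text \<open>
  The joint law of independent \<open>Y_1, \<dots>, Y_n1\<close>, each uniform on the unit interval; the sample
  points are exactly the (extensional) functions from \<open>{1..n1}\<close> to \<open>{0..1}\<close>.
\<close>

definition uniform_draws :: "nat \<Rightarrow> (nat \<Rightarrow> real) measure" where
  "uniform_draws n1 = Pi\<^sub>M {1..n1} (\<lambda>_. restrict_space lborel {0..1})"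

end

theory Submission
  imports Defs
begin

text \<open>
  SDMT-2 is a serial dictatorship in disguise. Once an agent is processed, the indifference class of
  what he owns never changes, and every object of that class is owned by somebody from then on.
  Agent \<open>i\<close> therefore receives the best class from which he can be served while all earlier agents
  keep their classes: if some assignment does this with \<open>i\<close> receiving \<open>x\<close>, then \<open>x\<close> is unallocated or
  the trading graph of \<open>x\<close> reaches a labelled agent, for otherwise the \<open>m\<close> reachable agents own
  exactly \<open>m\<close> objects, while the assignment gives \<open>m + 1\<close> different ones of these to them and \<open>i\<close>.
  Lowering the weight of \<open>i\<close> does not affect the agents before him, who hence obtain the
  same classes whatever \<open>i\<close> reports, and the outcome of a misreport is an assignment as above.
\<close>

section \<open>Highest objects\<close>

text \<open>A finite nonempty set has a maximum under a strict linear order; existence together with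
  uniqueness makes the description in \<open>highest\<close> meaningful. Totality is available on
  \<open>Obj\<close> only, hence \<open>A \<subseteq> Obj\<close>.\<close>

lemma highest_in:
  assumes "strict_linear_order_on Obj R" "finite A" "A \<noteq> {}" "A \<subseteq> Obj"
  shows "highest R A \<in> A"
proof -
  have tr: "trans R" and ir: "irrefl R" and tot: "total_on Obj R"
    using assms(1) by (auto simp: strict_linear_order_on_def)
  have "\<exists>x\<in>A. \<forall>y\<in>A. y \<noteq> x \<longrightarrow> (y, x) \<in> R"
    using assms(2-4)
  proof (induction rule: finite_ne_induct)
    case (singleton x)
    then show ?case by simp
  next
    case (insert a A)
    then obtain x where x: "x \<in> A" "\<forall>y\<in>A. y \<noteq> x \<longrightarrow> (y, x) \<in> R" by auto
    then consider "(a, x) \<in> R" | "(x, a) \<in> R"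
      using tot insert.prems insert.hyps unfolding total_on_def by (metis insert_subset subsetD)
    then show ?case
    proof cases
      case 1
      then show ?thesis using x by auto
    next
      case 2
      then have "\<forall>y\<in>A. (y, a) \<in> R" using x tr by (metis transD)
      then show ?thesis by auto
    qed
  qed
  then obtain x where x: "x \<in> A" "\<forall>y\<in>A. y \<noteq> x \<longrightarrow> (y, x) \<in> R" by blast
  have "highest R A = x"
    unfolding highest_def
  proof (rule the_equality)
    show "x \<in> A \<and> (\<forall>y\<in>A. y \<noteq> x \<longrightarrow> (y, x) \<in> R)" using x by blast
  next
    fix z assume "z \<in> A \<and> (\<forall>y\<in>A. y \<noteq> z \<longrightarrow> (y, z) \<in> R)"
    then show "z = x" using x tr ir by (metis irrefl_def transD)
  qed
  then show ?thesis using x by simp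
qed

section \<open>Preference lists\<close>

lemma valid_prefD:
  assumes "valid_pref Obj C"
  shows "C k \<subseteq> Obj" "x \<in> C k \<Longrightarrow> x \<in> C l \<Longrightarrow> k = l"
  using assms unfolding valid_pref_def by blast+

lemma valid_pref_le_card:
  assumes "valid_pref Obj C" "x \<in> C k"
  shows "k \<le> card Obj"
proof (rule ccontr)
  assume "\<not> k \<le> card Obj"
  \<comment> \<open>The class at index \<open>card Obj + 1\<close> is empty, and emptiness passes on
    to all later indices.\<close>
  then have "C k = {}"
    using assms(1) unfolding valid_pref_def
    by (metis Suc_eq_plus1 le_add2 not_less_eq_eq)
  then show False using assms(2) by simp
qed

lemma pref_rank_eq:
  assumes "valid_pref Obj C" "x \<in> C k"
  shows "pref_rank Obj C x = k"
proof -
  have "(THE k. x \<in> C k) = k"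
    using assms valid_prefD(2) by (intro the_equality) auto
  then show ?thesis using assms by (auto simp: pref_rank_def acceptable_def)
qed

text \<open>Guards the default values in \<open>SDMT2_step\<close>: if \<open>max_TG\<close> is
  \<open>None\<close>, then \<open>j2\<close> is \<open>card Obj + 1\<close>, so the test
  \<open>j1 \<le> j2\<close> succeeds and no trade is attempted with
  \<open>the None\<close>.\<close>

lemma first_class_le:
  assumes "valid_pref Obj C"
  shows "(if A \<inter> acceptable C \<noteq> {} then LEAST j. A \<inter> C j \<noteq> {} else card Obj + 1) \<le> card Obj + 1"
proof (cases "A \<inter> acceptable C = {}")
  case False
  then obtain x k where k: "x \<in> A" "x \<in> C k" by (auto simp: acceptable_def)
  then have "(LEAST j. A \<inter> C j \<noteq> {}) \<le> k" by (intro Least_le) blast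
  then show ?thesis using False valid_pref_le_card[OF assms k(2)] by simp
qed simp

section \<open>Trading paths\<close>

lemma TG_edge:
  assumes "(h, j) \<in> TG L own i B S"
  shows "h \<in> insert i S" "j \<in> S" "own j \<inter> wanted L own i B h \<noteq> {}" "h = i \<or> \<not> labelled own h"
  using assms by (cases; auto elim: TG.cases)+

text \<open>The edges out of the root depend on \<open>B\<close> alone, and the tail of every other
  edge lies in \<open>S\<close>, so no list outside \<open>S\<close> is consulted.\<close>

lemma TG_cong_subset:
  assumes "\<forall>j\<in>S. L j = L' j"
  shows "TG L own i B S \<subseteq> TG L' own i B S"
proof
  fix e assume "e \<in> TG L own i B S"
  then obtain h j where "e = (h, j)" "(h, j) \<in> TG L own i B S" by (cases e) auto
  from this(2) have "(h, j) \<in> TG L' own i B S"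
  proof (induction rule: TG.induct)
    case (start j)
    then show ?case by (intro TG.start) (auto simp: wanted_def)
  next
    case (step h j j')
    then have "L j = L' j" using assms TG_edge(2) by metis
    then have "wanted L own i B j = wanted L' own i B j" by (simp add: wanted_def)
    then show ?case using step TG.step by metis
  qed
  then show "e \<in> TG L' own i B S" using \<open>e = (h, j)\<close> by simp
qed

lemma TG_cong:
  assumes "\<forall>j\<in>S. L j = L' j"
  shows "TG L own i B S = TG L' own i B S"
  using assms TG_cong_subset[of S L L'] TG_cong_subset[of S L' L] by (metis subset_antisym)

text \<open>Induction along the walk: a new vertex either extends the path or already lies on it,
  and then the path is cut there.\<close>

lemma rtrancl_distinct_path:
  assumes "(a, b) \<in> G\<^sup>*"
  shows "\<exists>p. p \<noteq> [] \<and> hd p = a \<and> last p = b \<and> distinct p \<and> successively (\<lambda>x y. (x, y) \<in> G) p"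
  using assms
proof (induction rule: rtrancl_induct)
  case base
  then show ?case by (intro exI[of _ "[a]"]) simp
next
  case (step y z)
  then obtain p where p: "p \<noteq> []" "hd p = a" "last p = y" "distinct p"
      "successively (\<lambda>x y. (x, y) \<in> G) p" by blast
  show ?case
  proof (cases "z \<in> set p")
    case True
    then obtain q r where "p = q @ z # r" by (metis split_list)
    then have "hd (q @ [z]) = a" "distinct (q @ [z])" "successively (\<lambda>x y. (x, y) \<in> G) (q @ [z])"
      using p by (auto simp: hd_append successively_append_iff)
    then show ?thesis by (intro exI[of _ "q @ [z]"]) simp
  next
    case False
    then show ?thesis
      using p step.hyps(2) by (intro exI[of _ "p @ [z]"]) (auto simp: successively_append_iff)
  qed
qed

text \<open>Labelled agents other than the root have no outgoing edges. Hence only the end of a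
  simple path to a labelled agent can be labelled, and an unlabelled root is not that end.\<close>

lemma trading_path_exists:
  assumes "(i, j) \<in> (TG L own i B S)\<^sup>+" "labelled own j" "\<not> labelled own i"
  shows "\<exists>p. trading_path own (TG L own i B S) i p"
proof -
  obtain p where p: "p \<noteq> []" "hd p = i" "last p = j" "distinct p"
      "successively (\<lambda>x y. (x, y) \<in> TG L own i B S) p"
    using rtrancl_distinct_path[OF trancl_into_rtrancl[OF assms(1)]] by blast
  have edge: "(p ! s, p ! Suc s) \<in> TG L own i B S" if "Suc s < length p" for s
    using p(5) that by (simp add: successively_conv_nth)
  have "length p \<noteq> 1"
  proof
    assume "length p = 1"
    then have "hd p = last p" by (cases p) auto
    then show False using p assms by metis
  qed
  then have len: "length p \<ge> 2" using p(1) by (metis One_nat_def Suc_1 length_0_conv less_2_cases not_less)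
  have "\<not> labelled own h" if h: "h \<in> set (butlast p)" for h
  proof -
    obtain s where "s < length p - 1" "h = p ! s"
      using h by (metis in_set_conv_nth length_butlast nth_butlast)
    then have "(h, p ! Suc s) \<in> TG L own i B S" using edge[of s] by simp
    from TG_edge(4)[OF this] show ?thesis using assms(3) by auto
  qed
  then show ?thesis
    using p len edge assms(2) unfolding trading_path_def by blast
qed

lemma pass_along_other: "j \<notin> set p \<Longrightarrow> pass_along p x own j = own j"
  by (induction p x own rule: pass_along.induct) auto

lemma pass_along_last:
  "distinct p \<Longrightarrow> length p \<ge> 2 \<Longrightarrow> pass_along p x own (last p) = own (last p) - {x}"
proof (induction p x own rule: pass_along.induct)
  case (2 j j' j'' js x own)
  then have "last (j' # j'' # js) \<noteq> j" by (metis distinct.simps(2) last_in_set list.distinct(1))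
  then show ?case using 2 by simp
qed auto

text \<open>Objects move one place towards the head, so only what the head owned before gets lost.
  In a trade the head is the new agent, who owns nothing; the general form is needed because the
  induction drops the head and continues with an agent who may own something.\<close>

lemma pass_along_disjoint_Union:
  assumes "distinct p" "length p \<ge> 2" "x \<in> own (last p)"
    and "\<forall>j h. j \<noteq> h \<longrightarrow> own j \<inter> own h = {}"
  shows "(\<forall>j h. j \<noteq> h \<longrightarrow> pass_along p x own j \<inter> pass_along p x own h = {}) \<and>
    (\<Union>j. pass_along p x own j) = (\<Union>j. own j) - own (hd p)"
  using assms
proof (induction p x own rule: pass_along.induct)
  case (1 j j' x own)
  have d: "own a \<inter> own b = {}" if "a \<noteq> b" for a b using 1 that by blast
  have jj: "j \<noteq> j'" and x: "x \<in> own j'" using 1 by auto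
  let ?o = "own(j := {x}, j' := own j' - {x})"
  have disj': "?o a \<inter> ?o b = {}" if "a \<noteq> b" for a b
    using that d[of a b] d[of a j'] d[of j' b] x jj by (auto simp: fun_upd_def)
  have "(\<Union>j. ?o j) = (\<Union>j. own j) - own j"
  proof (intro equalityI subsetI)
    fix y
    assume "y \<in> (\<Union>j. ?o j)"
    then obtain a where "y \<in> ?o a" by blast
    then show "y \<in> (\<Union>j. own j) - own j"
      using d[of a j] d[of j' j] x jj by (auto simp: fun_upd_def split: if_splits)
  next
    fix y
    assume "y \<in> (\<Union>j. own j) - own j"
    then obtain a where "y \<in> own a" "a \<noteq> j" by blast
    then have "y \<in> ?o a \<or> y \<in> ?o j" using jj by (auto simp: fun_upd_def)
    then show "y \<in> (\<Union>j. ?o j)" by blast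
  qed
  with disj' show ?case unfolding pass_along.simps list.sel by blast
next
  case (2 j j' j'' js x own)
  let ?q = "j' # j'' # js"
  let ?o = "pass_along ?q x own"
  have d: "own a \<inter> own b = {}" if "a \<noteq> b" for a b using 2 that by blast
  have jj: "j \<noteq> j'" and jq: "j \<notin> set ?q" using 2 by auto
  have IH: "\<forall>j h. j \<noteq> h \<longrightarrow> ?o j \<inter> ?o h = {}" "(\<Union>j. ?o j) = (\<Union>j. own j) - own j'"
    using 2 by auto
  have oj: "?o j = own j" using pass_along_other[OF jq] .
  have disj: "?o a \<inter> own j' = {}" for a using IH(2) by blast
  \<comment> \<open>The recursive call loses \<open>own j'\<close>; handing it to \<open>j\<close>
    restores it and loses \<open>own j\<close> instead.\<close>
  let ?u = "?o(j := own j')"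
  have disj': "?u a \<inter> ?u b = {}" if "a \<noteq> b" for a b
    using that IH(1) disj[of a] disj[of b] by (auto simp: fun_upd_def)
  have "(\<Union>j. ?u j) = (\<Union>j. own j) - own j"
  proof (intro equalityI subsetI)
    fix y
    assume "y \<in> (\<Union>j. ?u j)"
    then obtain a where a: "y \<in> ?u a" by blast
    show "y \<in> (\<Union>j. own j) - own j"
    proof (cases "a = j")
      case True
      then show ?thesis using a d[of j' j] jj by auto
    next
      case False
      then have "y \<in> ?o a" using a by simp
      then have "y \<in> (\<Union>j. own j)" using IH(2) by blast
      moreover have "y \<notin> own j" using \<open>y \<in> ?o a\<close> False IH(1) oj by (metis disjoint_iff)
      ultimately show ?thesis by blast
    qed
  next
    fix y
    assume y: "y \<in> (\<Union>j. own j) - own j"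
    show "y \<in> (\<Union>j. ?u j)"
    proof (cases "y \<in> own j'")
      case True
      then have "y \<in> ?u j" by simp
      then show ?thesis by blast
    next
      case False
      then obtain a where "y \<in> ?o a" using y IH(2) by blast
      moreover from this have "a \<noteq> j" using y oj by auto
      ultimately have "y \<in> ?u a" by simp
      then show ?thesis by blast
    qed
  qed
  with disj' show ?case unfolding pass_along.simps list.sel by blast
qed auto

text \<open>An inner successor owns a single object, so meeting \<open>w j\<close> forces that
  object into \<open>w j\<close>; the agent before the last receives \<open>x\<close>, which is in
  his wanted set by assumption.\<close>

lemma pass_along_wanted:
  assumes "distinct p" "length p \<ge> 2" "successively (\<lambda>j j'. own j' \<inter> w j \<noteq> {}) p"
    and "\<forall>j\<in>set (tl (butlast p)). is_singleton (own j)" "x \<in> w (last (butlast p))"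
    and "j \<in> set (butlast p)"
  shows "pass_along p x own j \<noteq> {} \<and> pass_along p x own j \<subseteq> w j"
  using assms
proof (induction p x own rule: pass_along.induct)
  case (2 h j' j'' js x own)
  show ?case
  proof (cases "j = h")
    case True
    moreover have "is_singleton (own j')" "own j' \<inter> w h \<noteq> {}" using 2 by auto
    ultimately show ?thesis by (auto simp: is_singleton_def)
  next
    case False
    moreover have "pass_along (j' # j'' # js) x own j \<noteq> {} \<and> pass_along (j' # j'' # js) x own j \<subseteq> w j"
      using 2 False by (intro "2.IH") (auto dest: in_set_butlastD list.set_sel(2) split: if_splits)
    ultimately show ?thesis by simp
  qed
qed auto

section \<open>The order of the agents\<close>

text \<open>Smaller key first, ties by index: the strict order that the stable
  \<open>sort_key\<close> realises on an increasing list.\<close>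

definition precedes :: "('a::linorder \<Rightarrow> 'b::linorder) \<Rightarrow> 'a \<Rightarrow> 'a \<Rightarrow> bool" where
  "precedes f i j \<longleftrightarrow> f i < f j \<or> f i = f j \<and> i < j"

text \<open>Two different heads would each occur in the tail of the other list and so precede each
  other, against asymmetry.\<close>

lemma sorted_wrt_set_unique:
  assumes "sorted_wrt P xs" "sorted_wrt P ys" "distinct xs" "distinct ys" "set xs = set ys"
    and "\<And>x y. P x y \<Longrightarrow> \<not> P y x"
  shows "xs = ys"
  using assms(1-5)
proof (induction xs arbitrary: ys)
  case (Cons x xs)
  then obtain y ys' where ys: "ys = y # ys'" by (cases ys) auto
  have "x = y"
  proof (rule ccontr)
    assume "x \<noteq> y"
    then have "x \<in> set ys'" "y \<in> set xs" using Cons.prems(5) ys by auto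
    then have "P y x" "P x y" using Cons.prems(1,2) ys by auto
    then show False using assms(6) by blast
  qed
  moreover have "set xs = set ys'" using Cons.prems ys \<open>x = y\<close> by (auto dest: insert_ident)
  then have "xs = ys'" using Cons.prems ys by (intro Cons.IH) auto
  ultimately show ?case using ys by simp
qed simp

text \<open>\<open>insort_key\<close> places \<open>x\<close> in front of the elements with the same
  key, which is the correct tie-break because \<open>x\<close> is smaller than all of them.\<close>

lemma sorted_wrt_precedes_insort_key:
  "sorted_wrt (precedes f) xs \<Longrightarrow> \<forall>y\<in>set xs. x < y \<Longrightarrow> sorted_wrt (precedes f) (insort_key f x xs)"
proof (induction xs)
  case (Cons y ys)
  then show ?case by (auto simp: set_insort_key precedes_def)
qed simp

lemma sorted_wrt_precedes_sort_key:
  "sorted_wrt (<) xs \<Longrightarrow> sorted_wrt (precedes f) (sort_key f xs)"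
proof (induction xs)
  case (Cons x xs)
  then have "sorted_wrt (precedes f) (insort_key f x (sort_key f xs))"
    by (intro sorted_wrt_precedes_insort_key) simp_all
  then show ?case by simp
qed simp

text \<open>Characterises the sorted list by its properties. A guessed result can thus be verified,
  and the event that a given order occurs becomes a finite conjunction of key comparisons.\<close>

lemma sort_key_eq_iff:
  assumes "sorted_wrt (<) xs"
  shows "sort_key f xs = ys \<longleftrightarrow> distinct ys \<and> set ys = set xs \<and> sorted_wrt (precedes f) ys"
proof
  assume "sort_key f xs = ys"
  then show "distinct ys \<and> set ys = set xs \<and> sorted_wrt (precedes f) ys"
    using sorted_wrt_precedes_sort_key[OF assms] strict_sorted_iff[of xs] assms by auto
next
  assume ys: "distinct ys \<and> set ys = set xs \<and> sorted_wrt (precedes f) ys"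
  have "distinct (sort_key f xs)" using assms strict_sorted_iff[of xs] by simp
  then show "sort_key f xs = ys"
    using ys sorted_wrt_precedes_sort_key[OF assms]
    by (intro sorted_wrt_set_unique[of "precedes f"]) (auto simp: precedes_def)
qed

text \<open>Raising the key of \<open>i\<close> can only move \<open>i\<close> backwards. All of
  \<open>pre\<close> still precedes everything else, so \<open>pre\<close> followed by the sorted
  remainder is sorted.\<close>

lemma sort_key_prefix:
  fixes xs :: "'a::linorder list"
  assumes "sorted_wrt (<) xs" "sort_key f xs = pre @ i # post"
    and same: "\<And>j. j \<noteq> i \<Longrightarrow> g j = f j" and "f i \<le> g i"
  shows "\<exists>rest. sort_key g xs = pre @ rest"
proof -
  have xs: "distinct (pre @ i # post)" "set (pre @ i # post) = set xs"
      "sorted_wrt (precedes f) (pre @ i # post)"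
    using assms(2) sort_key_eq_iff[OF assms(1)] by blast+
  \<comment> \<open>The remainder is first sorted by index, so that \<open>sort_key_eq_iff\<close>
    applies and ties are broken correctly.\<close>
  define rest where "rest = sort_key g (sort (i # post))"
  have srt: "sorted_wrt (<) (sort (i # post))" using xs(1) by (simp add: strict_sorted_iff del: sort_key_simps)
  have rest: "distinct rest" "set rest = insert i (set post)" "sorted_wrt (precedes g) rest"
    using sort_key_eq_iff[OF srt, of g rest] rest_def by (metis, metis list.simps(15) set_sort, metis)
  have less: "precedes g j k" if "j \<in> set pre" "k \<in> set rest" for j k
  proof -
    have "precedes f j k" "j \<noteq> i" using that xs rest(2) by (auto simp: sorted_wrt_append)
    then show ?thesis using same assms(4) by (cases "k = i") (auto simp: precedes_def)
  qed
  have "sorted_wrt (precedes f) pre" using xs(3) by (simp add: sorted_wrt_append)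
  then have "sorted_wrt (precedes g) pre"
  proof (rule sorted_wrt_mono_rel[rotated])
    fix j k assume "j \<in> set pre" "k \<in> set pre" "precedes f j k"
    then have "j \<noteq> i" "k \<noteq> i" using xs(1) by auto
    then show "precedes g j k" using same \<open>precedes f j k\<close> by (simp add: precedes_def)
  qed
  then have "sorted_wrt (precedes g) (pre @ rest)"
    using rest less by (simp add: sorted_wrt_append)
  then have "sort_key g xs = pre @ rest"
    using xs rest by (subst sort_key_eq_iff[OF assms(1)]) auto
  then show ?thesis by blast
qed

lemma agent_order_properties:
  "distinct (agent_order n1 Y W)" "set (agent_order n1 Y W) = {1..n1}"
  by (auto simp: agent_order_def)

lemma agent_order_eq_iff:
  "agent_order n1 Y W = xs \<longleftrightarrow>
     distinct xs \<and> set xs = {1..n1} \<and> sorted_wrt (precedes (\<lambda>i. - (W i * (1 - exp (Y i - 1))))) xs"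
proof -
  have "sorted_wrt (<) [1..<n1 + 1]" "set [1..<n1 + 1] = {1..n1}"
    by (auto simp del: upt_Suc)
  then show ?thesis unfolding agent_order_def by (simp only: sort_key_eq_iff)
qed

text \<open>Since \<open>Y i \<le> 1\<close>, the factor of the weight is nonnegative, so a lower
  weight gives a larger key. This is where the ban on over-bidding enters.\<close>

lemma agent_order_prefix:
  assumes "agent_order n1 Y W = pre @ i # post" "Y i \<le> 1" "w' \<le> W i"
  shows "\<exists>rest. agent_order n1 Y (W(i := w')) = pre @ rest"
  unfolding agent_order_def
proof (rule sort_key_prefix)
  show "sort_key (\<lambda>i. - (W i * (1 - exp (Y i - 1)))) [1..<n1 + 1] = pre @ i # post"
    using assms(1) unfolding agent_order_def .
  have "1 - exp (Y i - 1) \<ge> 0" using assms(2) by simp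
  then show "- (W i * (1 - exp (Y i - 1))) \<le> - ((W(i := w')) i * (1 - exp (Y i - 1)))"
    using assms(3) by (simp add: mult_right_mono)
qed (auto simp del: upt_Suc)

section \<open>The random order as a random variable\<close>

lemma sets_precedes:
  fixes f :: "'w \<Rightarrow> 'a::linorder \<Rightarrow> real"
  assumes [measurable]: "(\<lambda>w. f w a) \<in> borel_measurable M" "(\<lambda>w. f w b) \<in> borel_measurable M"
  shows "{w \<in> space M. precedes (f w) a b} \<in> sets M"
\<comment> \<open>For fixed \<open>a\<close> and \<open>b\<close> the tie-break is decided, and
  \<open>precedes\<close> is a weak or a strict inequality of the keys.\<close>
proof (cases "a < b")
  case True
  have "{w \<in> space M. f w a \<le> f w b} \<in> sets M" by measurable
  then show ?thesis using True by (simp add: precedes_def le_less)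
next
  case False
  have "{w \<in> space M. f w a < f w b} \<in> sets M" by measurable
  then show ?thesis using False by (simp add: precedes_def)
qed

text \<open>There are only countably many lists, so preimages of single lists suffice: such a
  preimage is a finite intersection of key comparisons, or empty if the list is no permutation of
  the agents.\<close>

lemma agent_order_measurable:
  "(\<lambda>Y. agent_order n1 Y W) \<in> uniform_draws n1 \<rightarrow>\<^sub>M count_space UNIV"
proof (subst measurable_count_space_eq_countable)
  show "countable (UNIV :: nat list set)" by simp
  let ?U = "uniform_draws n1"
  let ?key = "\<lambda>Y i. - (W i * (1 - exp (Y i - 1))) :: real"
  have key: "(\<lambda>Y. ?key Y i) \<in> borel_measurable ?U" if "i \<in> {1..n1}" for i
  proof -
    have "(\<lambda>Y. Y i) \<in> ?U \<rightarrow>\<^sub>M restrict_space lborel {0..1}"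
      unfolding uniform_draws_def using that by (rule measurable_component_singleton)
    then have [measurable]: "(\<lambda>Y. Y i) \<in> borel_measurable ?U"
      by (simp add: measurable_restrict_space2_iff)
    show ?thesis by measurable
  qed
  have "{Y \<in> space ?U. agent_order n1 Y W = xs} \<in> sets ?U" for xs
  proof (cases "distinct xs \<and> set xs = {1..n1}")
    case True
    have "{Y \<in> space ?U. agent_order n1 Y W = xs} =
        {Y \<in> space ?U. \<forall>b\<in>{..<length xs}. \<forall>a\<in>{..<b}. precedes (?key Y) (xs ! a) (xs ! b)}"
      using True by (auto simp: agent_order_eq_iff sorted_wrt_iff_nth_less)
    also have "\<dots> \<in> sets ?U"
    proof (intro sets.sets_Collect_finite_All)
      fix a b assume "b \<in> {..<length xs}" "a \<in> {..<b}"
      then have "xs ! a \<in> set xs" "xs ! b \<in> set xs" by simp_all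
      then show "{Y \<in> space ?U. precedes (?key Y) (xs ! a) (xs ! b)} \<in> sets ?U"
        using True key by (intro sets_precedes) blast+
    qed auto
    finally show ?thesis .
  next
    case False
    then have "{Y \<in> space ?U. agent_order n1 Y W = xs} = {}"
      using agent_order_properties by blast
    then show ?thesis by (metis sets.empty_sets)
  qed
  then show "(\<lambda>Y. agent_order n1 Y W) \<in> space ?U \<rightarrow> UNIV \<and>
    (\<forall>xs\<in>UNIV. (\<lambda>Y. agent_order n1 Y W) -` {xs} \<inter> space ?U \<in> sets ?U)"
    by (simp add: vimage_def Int_def conj_commute)
qed

lemma prob_space_uniform_draws: "prob_space (uniform_draws n1)"
proof -
  have "prob_space (restrict_space lborel {0..1::real})"
    by (intro prob_space_restrict_space) auto
  then show ?thesis unfolding uniform_draws_def by (intro prob_space_PiM)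
qed

section \<open>The invariant of SDMT-2\<close>

text \<open>The last clause demands more than holdings inside one class: the whole class must be
  allocated. Hall's argument needs this, as each object of the class then has an owner to whom an
  edge can lead.\<close>

definition ownership_inv :: "'o profile \<Rightarrow> nat set \<Rightarrow> 'o ownership \<Rightarrow> bool" where
  "ownership_inv L S own \<longleftrightarrow>
     (\<forall>j h. j \<noteq> h \<longrightarrow> own j \<inter> own h = {}) \<and>
     (\<forall>j. j \<notin> S \<longrightarrow> own j = {}) \<and>
     (\<forall>j. own j \<noteq> {} \<longrightarrow> (\<exists>k. own j \<subseteq> L j k \<and> L j k \<subseteq> (\<Union>h. own h)))"

text \<open>For nonempty \<open>own j\<close> and disjoint classes at most one \<open>k\<close>
  qualifies. Agents who own nothing impose no condition.\<close>

definition classes_kept :: "'o profile \<Rightarrow> nat set \<Rightarrow> 'o ownership \<Rightarrow> 'o ownership \<Rightarrow> bool" where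
  "classes_kept L S own own' \<longleftrightarrow>
     (\<forall>j\<in>S. own j \<noteq> {} \<longrightarrow> own' j \<noteq> {} \<and> (\<forall>k. own j \<subseteq> L j k \<longrightarrow> own' j \<subseteq> L j k))"

lemma ownership_invD:
  assumes "ownership_inv L S own"
  shows "j \<noteq> h \<Longrightarrow> own j \<inter> own h = {}" "j \<notin> S \<Longrightarrow> own j = {}"
    "own j \<noteq> {} \<Longrightarrow> \<exists>k. own j \<subseteq> L j k \<and> L j k \<subseteq> (\<Union>h. own h)"
  using assms unfolding ownership_inv_def by blast+

lemma ownership_inv_Union:
  assumes "ownership_inv L S own"
  shows "(\<Union>h\<in>S. own h) = (\<Union>h. own h)"
  using ownership_invD(2)[OF assms] by blast

lemma classes_kept_trans:
  assumes "classes_kept L S own own'" "classes_kept L S own' own''"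
  shows "classes_kept L S own own''"
  using assms unfolding classes_kept_def by meson

section \<open>Fixed tie-breaking order and path rule; the best tradable object\<close>

locale house_allocation =
  fixes Obj :: "'o set" and R :: "'o rel" and pick :: "'o path_rule"
  assumes finite_Obj: "finite Obj"
    and order_R: "strict_linear_order_on Obj R"
    and pick: "valid_path_rule pick"
begin

lemma highest_mem:
  assumes "A \<noteq> {}" "A \<subseteq> Obj"
  shows "highest R A \<in> A"
  using highest_in[OF order_R _ assms] assms(2) finite_Obj finite_subset by blast

lemma own_subset:
  assumes "ownership_inv L S own" "\<forall>j\<in>S. valid_pref Obj (L j)"
  shows "own j \<subseteq> Obj"
proof (cases "own j = {}")
  case False
  then show ?thesis using ownership_invD(2,3)[OF assms(1)] valid_prefD(1) assms(2) by (metis subset_trans)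
qed simp

lemma max_TG_Some:
  assumes "max_TG R L own i S = Some a" "valid_pref Obj (L i)"
  obtains l where "a \<in> tradable L own i S" "a \<in> L i l" "pref_rank Obj (L i) a = l"
    "\<And>k x. x \<in> tradable L own i S \<Longrightarrow> x \<in> L i k \<Longrightarrow> l \<le> k"
proof -
  let ?H = "tradable L own i S"
  let ?l = "LEAST l. ?H \<inter> L i l \<noteq> {}"
  have H: "?H \<noteq> {}" and a: "a = highest R (?H \<inter> L i ?l)"
    using assms(1) by (auto simp: max_TG_def Let_def split: if_splits)
  then obtain l where "?H \<inter> L i l \<noteq> {}" by (auto simp: tradable_def acceptable_def)
  then have "?H \<inter> L i ?l \<noteq> {}" by (rule LeastI)
  moreover have "?H \<inter> L i ?l \<subseteq> Obj" using valid_prefD(1)[OF assms(2)] by blast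
  ultimately have "a \<in> ?H \<inter> L i ?l" using a highest_mem by metis
  moreover have "?l \<le> k" if "x \<in> ?H" "x \<in> L i k" for k x
    using that by (intro Least_le) blast
  ultimately show thesis using that[of ?l] pref_rank_eq[OF assms(2)] by blast
qed

lemma max_TG_None: "max_TG R L own i S = None \<Longrightarrow> tradable L own i S = {}"
  by (auto simp: max_TG_def Let_def split: if_splits)

lemma picked_path:
  assumes "ownership_inv L S own" "i \<notin> S" "a \<in> tradable L own i S"
  shows "trading_path own (TG L own i {a} S) i (pick own (TG L own i {a} S) i)"
proof -
  have "\<not> labelled own i" using ownership_invD(2)[OF assms(1,2)] by (simp add: labelled_def)
  then have "\<exists>p. trading_path own (TG L own i {a} S) i p"
    using assms(3) trading_path_exists unfolding tradable_def by blast
  then show ?thesis using pick unfolding valid_path_rule_def by blast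
qed

section \<open>The effect of one trade\<close>

lemma trading_path_properties:
  assumes "ownership_inv L S own" "\<forall>j\<in>S. valid_pref Obj (L j)" "i \<notin> S"
    and "trading_path own (TG L own i B S) i p"
  defines "w \<equiv> wanted L own i B"
  shows "distinct p" "length p \<ge> 2" "hd p = i" "set (tl p) \<subseteq> S" "labelled own (last p)"
    and "successively (\<lambda>j j'. own j' \<inter> w j \<noteq> {}) p"
    and "\<forall>j\<in>set (tl (butlast p)). is_singleton (own j)"
    and "own (last p) \<inter> w (last (butlast p)) \<noteq> {}"
    and "last (butlast p) \<in> insert i S"
proof -
  let ?G = "TG L own i B S"
  have edge: "(p ! s, p ! Suc s) \<in> ?G" if "Suc s < length p" for s
    using assms(4) that unfolding trading_path_def by blast
  show dist: "distinct p" and len: "length p \<ge> 2" and hd: "hd p = i" and "labelled own (last p)"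
    using assms(4) unfolding trading_path_def by blast+
  show succ: "successively (\<lambda>j j'. own j' \<inter> w j \<noteq> {}) p"
    unfolding successively_conv_nth w_def using edge TG_edge(3) by blast
  have tl: "\<exists>s. Suc s < length p \<and> j = p ! Suc s" if "j \<in> set (tl p)" for j
    using that by (auto simp: in_set_conv_nth nth_tl less_diff_conv)
  show "set (tl p) \<subseteq> S" using tl edge TG_edge(2) by blast
  \<comment> \<open>An inner agent is pointed to, so he owns something, and he is unlabelled, so he
    owns at most one object. Finiteness is needed because \<open>card\<close> of an infinite set is
    0.\<close>
  show "\<forall>j\<in>set (tl (butlast p)). is_singleton (own j)"
  proof
    fix j assume j: "j \<in> set (tl (butlast p))"
    then have "j \<in> set (butlast p)" by (metis list.sel(2) list.set_sel(2))
    then have unl: "\<not> labelled own j" using assms(4) unfolding trading_path_def by blast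
    have "j \<in> set (tl p)" using j by (metis butlast_tl in_set_butlastD)
    then have "own j \<noteq> {}" using tl edge TG_edge(3) by blast
    moreover have "finite (own j)"
      using own_subset[OF assms(1,2)] finite_Obj finite_subset by blast
    ultimately show "is_singleton (own j)"
      using unl unfolding labelled_def is_singleton_altdef
      by (metis card_0_eq less_one linorder_neqE_nat)
  qed
  obtain m where m: "length p = Suc (Suc m)" using len by (metis Suc_1 Suc_le_D Suc_le_mono le_Suc_ex add_2_eq_Suc)
  have "last p = p ! Suc m" "last (butlast p) = p ! m"
    using m by (auto simp: last_conv_nth nth_butlast simp flip: length_0_conv)
  then show "own (last p) \<inter> w (last (butlast p)) \<noteq> {}" "last (butlast p) \<in> insert i S"
    using edge[of m] TG_edge(1,3) m unfolding w_def by fastforce+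
qed

lemma trading_properties:
  assumes inv: "ownership_inv L S own" and val: "\<forall>j\<in>S. valid_pref Obj (L j)" and "i \<notin> S"
    and "a \<in> tradable L own i S"
  defines "own' \<equiv> trading R pick L i a S own"
  shows "own' i = {a}" "classes_kept L S own own'" "\<And>j. j \<notin> insert i S \<Longrightarrow> own' j = {}"
    and "\<And>j. j \<in> S \<Longrightarrow> own j = {} \<Longrightarrow> own' j = {}"
    and "\<And>j h. j \<noteq> h \<Longrightarrow> own' j \<inter> own' h = {}" "(\<Union>j. own' j) = (\<Union>j. own j)"
proof -
  define p where "p = pick own (TG L own i {a} S) i"
  define w where "w = wanted L own i {a}"
  define x where "x = highest R (own (last p) \<inter> w (last (butlast p)))"
  have own': "own' = pass_along p x own"
    by (simp add: own'_def trading_def Let_def p_def x_def w_def)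
  note path = trading_path_properties[OF inv val \<open>i \<notin> S\<close>
      picked_path[OF inv \<open>i \<notin> S\<close> assms(4)], folded p_def w_def]
  have "x \<in> own (last p) \<inter> w (last (butlast p))"
    unfolding x_def using path(8) own_subset[OF inv val] by (intro highest_mem) blast+
  then have x: "x \<in> own (last p)" "x \<in> w (last (butlast p))" by auto
  have pne: "p \<noteq> []" "butlast p \<noteq> []" using path(2) by (cases p; auto)+
  have set_p: "set p = insert i (set (tl p))" using path(3) pne by (metis list.exhaust_sel list.simps(15))
  have served: "own' j \<noteq> {} \<and> own' j \<subseteq> w j" if "j \<in> set (butlast p)" for j
    unfolding own' using pass_along_wanted path x that by metis
  have "i \<in> set (butlast p)"
    using pne path(3) by (cases p) (auto split: if_splits)
  then show "own' i = {a}" using served[of i] by (auto simp: w_def wanted_def)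
  have own_i: "own i = {}" using ownership_invD(2)[OF inv \<open>i \<notin> S\<close>] .
  show "\<And>j. j \<notin> insert i S \<Longrightarrow> own' j = {}"
    using pass_along_other set_p path(4) ownership_invD(2)[OF inv] unfolding own' by (metis insertE insertI1 insertI2 subsetD)
  have "\<forall>j h. j \<noteq> h \<longrightarrow> own j \<inter> own h = {}" using ownership_invD(1)[OF inv] by blast
  from pass_along_disjoint_Union[OF path(1,2) x(1) this]
  show "\<And>j h. j \<noteq> h \<Longrightarrow> own' j \<inter> own' h = {}" "(\<Union>j. own' j) = (\<Union>j. own j)"
    using own_i path(3) by (auto simp: own')
  have p_cases: "j = last p \<or> j \<in> set (butlast p)" if "j \<in> set p" for j
    using that pne(1) by (metis append_butlast_last_id rotate1.simps(2) set_ConsD set_rotate1)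
  \<comment> \<open>The last agent is labelled, so giving away \<open>x\<close> leaves him with
    something of his class.\<close>
  have lab: "own (last p) - {x} \<noteq> {}"
  proof
    assume "own (last p) - {x} = {}"
    then have "card (own (last p)) \<le> card {x}" by (intro card_mono) auto
    then show False using path(5) by (simp add: labelled_def)
  qed
  show empty: "\<And>j. j \<in> S \<Longrightarrow> own j = {} \<Longrightarrow> own' j = {}"
  proof -
    fix j assume j: "j \<in> S" "own j = {}"
    \<comment> \<open>After the root, every agent on the path owns something: the inner ones a
      single object, the last one several.\<close>
    have "j \<notin> set p"
    proof
      assume "j \<in> set p"
      then have "j \<in> set (tl p)" using set_p j \<open>i \<notin> S\<close> by auto
      moreover have "j \<noteq> last p" using lab j by auto
      ultimately have "j \<in> set (tl (butlast p))"
        using p_cases[OF \<open>j \<in> set p\<close>] j \<open>i \<notin> S\<close> path(3) pne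
        by (cases p) (auto split: if_splits)
      then show False using path(7) j by (auto simp: is_singleton_def)
    qed
    then show "own' j = {}" using pass_along_other j unfolding own' by metis
  qed
  show "classes_kept L S own own'"
    unfolding classes_kept_def
  proof (intro ballI impI conjI allI)
    fix j assume j: "j \<in> S" "own j \<noteq> {}"
    have cl: "own' j \<noteq> {} \<and> (\<forall>k. own j \<subseteq> L j k \<longrightarrow> own' j \<subseteq> L j k)"
    proof (cases "j \<in> set p")
      case False
      then show ?thesis using j pass_along_other unfolding own' by metis
    next
      case True
      then consider "j = last p" | "j \<in> set (butlast p)" using p_cases by blast
      then show ?thesis
      proof cases
        case 1
        then have "own' j = own j - {x}"
          using pass_along_last path(1,2) unfolding own' by metis
        then show ?thesis using lab 1 by auto
      next
        case 2
        \<comment> \<open>The classes are disjoint, so \<open>L j k\<close> is the only one that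
          \<open>own j\<close> meets, and the union in \<open>wanted\<close> reduces to it.\<close>
        have "w j \<subseteq> L j k" if "own j \<subseteq> L j k" for k
        proof -
          have "j \<noteq> i" using j \<open>i \<notin> S\<close> by blast
          moreover have "l = k" if "own j \<inter> L j l \<noteq> {}" for l
            using that \<open>own j \<subseteq> L j k\<close> valid_prefD(2) val j(1) by (metis IntE equals0I subsetD)
          ultimately show ?thesis unfolding w_def wanted_def by auto
        qed
        then show ?thesis using served[OF 2] by blast
      qed
    qed
    show "own' j \<noteq> {}" using cl by blast
    show "own' j \<subseteq> L j k" if "own j \<subseteq> L j k" for k using cl that by blast
  qed
qed

section \<open>Optimality and invariance of a single step\<close>

text \<open>
  Hall's argument: the agents reachable in the trading graph of \<open>M i\<close> cannot all be unlabelled,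
  since \<open>M\<close> serves them and \<open>i\<close> from the objects they own.
\<close>

lemma assignment_tradable:
  assumes inv: "ownership_inv L S own" and "finite S" "i \<notin> S"
    and val: "\<forall>j\<in>S. valid_pref Obj (L j)"
    and inj: "inj_on M (insert i {j\<in>S. own j \<noteq> {}})"
    and M: "\<And>j k. j \<in> S \<Longrightarrow> own j \<noteq> {} \<Longrightarrow> own j \<subseteq> L j k \<Longrightarrow> M j \<in> L j k"
    and Mi: "M i \<in> acceptable (L i)" "M i \<in> (\<Union>h. own h)"
  shows "M i \<in> tradable L own i S"
proof (rule ccontr)
  assume contra: "M i \<notin> tradable L own i S"
  let ?G = "TG L own i {M i} S"
  define T where "T = {j. (i, j) \<in> ?G\<^sup>+}"
  have unl: "\<not> labelled own j" if "j \<in> T" for j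
    using contra that Mi(1) unfolding tradable_def T_def by blast
  have T: "j \<in> S" "own j \<noteq> {}" "\<exists>h. (h, j) \<in> ?G" if "j \<in> T" for j
  proof -
    show "\<exists>h. (h, j) \<in> ?G" using that tranclD2 unfolding T_def by fastforce
    then show "j \<in> S" "own j \<noteq> {}" using TG_edge(2,3) by blast+
  qed
  have "finite T" "i \<notin> T" using T(1) assms(2,3) by (auto intro: finite_subset)
  have "M j \<in> (\<Union>h\<in>T. own h)" if "j \<in> insert i T" for j
  proof (cases "j = i")
    case True
    obtain h where h: "M i \<in> own h" using Mi(2) by blast
    then have "h \<in> S" using ownership_invD(2)[OF inv] by blast
    then have "(i, h) \<in> ?G" using h by (intro TG.start) (auto simp: wanted_def)
    then show ?thesis using True h unfolding T_def by blast
  next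
    case False
    then have j: "j \<in> T" using that by blast
    obtain k where k: "own j \<subseteq> L j k" "L j k \<subseteq> (\<Union>h. own h)"
      using ownership_invD(3)[OF inv T(2)[OF j]] by blast
    then have Mj: "M j \<in> L j k" using M T j by blast
    then obtain h where h: "M j \<in> own h" using k by blast
    then have "h \<in> S" using ownership_invD(2)[OF inv] by blast
    \<comment> \<open>The owner \<open>h\<close> of \<open>M j\<close> is \<open>j\<close> himself
      or somebody to whom the unlabelled \<open>j\<close> points; in both cases \<open>h\<close> is
      reachable.\<close>
    show ?thesis
    proof (cases "h = j")
      case True
      then show ?thesis using h j by blast
    next
      case False
      then have "M j \<notin> own j" using ownership_invD(1)[OF inv False] h by blast
      moreover have "own j \<inter> L j k \<noteq> {}" using k T(2)[OF j] by blast
      ultimately have "M j \<in> wanted L own i {M i} j" using \<open>j \<noteq> i\<close> Mj by (auto simp: wanted_def)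
      then have "(j, h) \<in> ?G" using TG.step T(3)[OF j] unl[OF j] \<open>h \<in> S\<close> h by blast
      then have "h \<in> T" using j unfolding T_def by (auto intro: trancl_into_trancl)
      then show ?thesis using h by blast
    qed
  qed
  then have sub: "M ` insert i T \<subseteq> (\<Union>h\<in>T. own h)" by blast
  have fin: "finite (own j)" if "j \<in> T" for j
    using own_subset[OF inv val] finite_Obj finite_subset by blast
  have "inj_on M (insert i T)" by (rule inj_on_subset[OF inj]) (use T in auto)
  then have "card (insert i T) \<le> card (\<Union>h\<in>T. own h)"
    using sub \<open>finite T\<close> fin by (metis card_image card_mono finite_UN_I)
  also have "\<dots> \<le> (\<Sum>h\<in>T. card (own h))" using \<open>finite T\<close> by (rule card_UN_le)
  also have "\<dots> \<le> (\<Sum>h\<in>T. 1)" using unl by (intro sum_mono) (auto simp: labelled_def not_less)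
  finally show False using \<open>finite T\<close> \<open>i \<notin> T\<close> by simp
qed

text \<open>The third fact is the optimality of the step: \<open>M\<close> ranges over all
  assignments of different objects that respect the classes of the earlier agents, and
  \<open>i\<close> does at least as well as under \<open>M\<close>.\<close>

lemma SDMT2_step_properties:
  assumes inv: "ownership_inv L S own" and "finite S" "i \<notin> S"
    and val: "\<forall>j\<in>insert i S. valid_pref Obj (L j)"
  defines "own' \<equiv> SDMT2_step Obj R pick L i S own"
  shows "ownership_inv L (insert i S) own'" "classes_kept L S own own'"
    and "\<And>M k. inj_on M (insert i {j\<in>S. own j \<noteq> {}}) \<Longrightarrow>
      (\<And>j k. j \<in> S \<Longrightarrow> own j \<noteq> {} \<Longrightarrow> own j \<subseteq> L j k \<Longrightarrow> M j \<in> L j k) \<Longrightarrow> M i \<in> L i k \<Longrightarrow>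
      own' i \<noteq> {} \<and> (\<exists>l\<le>k. own' i \<subseteq> L i l)"
proof -
  have val_i: "valid_pref Obj (L i)" and val_S: "\<forall>j\<in>S. valid_pref Obj (L j)" using val by auto
  define Oi where "Oi = Obj - (\<Union>h. own h)"
  define j1 where "j1 = (if Oi \<inter> acceptable (L i) \<noteq> {} then LEAST j. Oi \<inter> L i j \<noteq> {} else card Obj + 1)"
  define j2 where "j2 = (case max_TG R L own i S of None \<Rightarrow> card Obj + 1 | Some a \<Rightarrow> pref_rank Obj (L i) a)"
  have own'_eq: "own' = (if j1 \<le> j2 then own(i := Oi \<inter> L i j1)
      else trading R pick L i (the (max_TG R L own i S)) S own)"
    by (simp add: own'_def SDMT2_step_def Let_def ownership_inv_Union[OF inv] Oi_def j1_def j2_def)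
  have j1: "j1 \<le> k" "Oi \<inter> L i j1 \<noteq> {}" if "x \<in> Oi" "x \<in> L i k" for x k
  proof -
    have eq: "j1 = (LEAST j. Oi \<inter> L i j \<noteq> {})" using that by (auto simp: j1_def acceptable_def)
    have ne: "Oi \<inter> L i k \<noteq> {}" using that by blast
    show "j1 \<le> k" using eq ne by (simp add: Least_le)
    show "Oi \<inter> L i j1 \<noteq> {}" unfolding eq using ne by (rule LeastI)
  qed
  have j1_le: "j1 \<le> card Obj + 1" unfolding j1_def using first_class_le[OF val_i] .
  \<comment> \<open>As \<open>j1\<close> never exceeds the default \<open>card Obj + 1\<close>, a
    smaller \<open>j2\<close> cannot be the default and comes from an actual tradable
    object.\<close>
  have trade: "\<exists>a. max_TG R L own i S = Some a \<and> a \<in> tradable L own i S \<and> a \<in> L i j2 \<and> j2 < j1"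
    if less: "\<not> j1 \<le> j2"
  proof -
    obtain a where a: "max_TG R L own i S = Some a"
      using less j1_le by (cases "max_TG R L own i S") (auto simp: j2_def)
    from max_TG_Some[OF a val_i] show ?thesis using a less by (auto simp: j2_def)
  qed
  have own_i: "own i = {}" using ownership_invD(2)[OF inv \<open>i \<notin> S\<close>] .
  have "ownership_inv L (insert i S) own' \<and> classes_kept L S own own'"
  proof (cases "j1 \<le> j2")
    case True
    then have own': "own' = own(i := Oi \<inter> L i j1)" using own'_eq by simp
    have un: "(\<Union>h. own' h) = (\<Union>h. own h) \<union> (Oi \<inter> L i j1)"
    proof (intro equalityI subsetI)
      fix y assume "y \<in> (\<Union>h. own' h)"
      then obtain h where "y \<in> own' h" by blast
      then show "y \<in> (\<Union>h. own h) \<union> (Oi \<inter> L i j1)" unfolding own' by (cases "h = i") auto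
    next
      fix y assume "y \<in> (\<Union>h. own h) \<union> (Oi \<inter> L i j1)"
      then consider h where "y \<in> own h" "h \<noteq> i" | "y \<in> Oi \<inter> L i j1" using own_i by blast
      then have "\<exists>h. y \<in> own' h" unfolding own' by cases (metis fun_upd_apply)+
      then show "y \<in> (\<Union>h. own' h)" by blast
    qed
    have "classes_kept L S own own'" using \<open>i \<notin> S\<close> by (auto simp: classes_kept_def own')
    moreover have "own' j \<inter> own' h = {}" if "j \<noteq> h" for j h
      using ownership_invD(1)[OF inv that] that by (auto simp: own' Oi_def)
    moreover have "own' j = {}" if "j \<notin> insert i S" for j
      using ownership_invD(2)[OF inv] that by (auto simp: own')
    moreover have "\<exists>k. own' j \<subseteq> L j k \<and> L j k \<subseteq> (\<Union>h. own' h)" if "own' j \<noteq> {}" for j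
    proof (cases "j = i")
      case True
      \<comment> \<open>An object of the class \<open>j1\<close> was either owned before or is
        unallocated, and then \<open>i\<close> receives it now.\<close>
      then have "own' j \<subseteq> L i j1 \<and> L i j1 \<subseteq> (\<Union>h. own' h)"
        using valid_prefD(1)[OF val_i] unfolding un by (auto simp: own' Oi_def)
      then show ?thesis using True by blast
    next
      case False
      then have "own' j = own j" by (simp add: own')
      then show ?thesis using ownership_invD(3)[OF inv] that unfolding un by (metis le_supI1)
    qed
    ultimately show ?thesis unfolding ownership_inv_def by blast
  next
    case False
    then obtain a where a: "max_TG R L own i S = Some a" "a \<in> tradable L own i S" "a \<in> L i j2" "j2 < j1"
      using trade by blast
    then have own': "own' = trading R pick L i a S own" using own'_eq by simp
    note t = trading_properties[OF inv val_S \<open>i \<notin> S\<close> a(2), folded own']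
    \<comment> \<open>An unallocated object of this class would give
      \<open>j1 \<le> j2\<close>.\<close>
    have "L i j2 \<subseteq> (\<Union>h. own h)"
      using j1(1) a(4) valid_prefD(1)[OF val_i] unfolding Oi_def by (meson DiffI leD subset_iff)
    then have "\<exists>k. own' j \<subseteq> L j k \<and> L j k \<subseteq> (\<Union>h. own' h)" if ne: "own' j \<noteq> {}" for j
    proof (cases "j = i")
      case True
      then show ?thesis using t(1,6) a(3) \<open>L i j2 \<subseteq> _\<close> by (intro exI[of _ j2]) auto
    next
      case False
      then have "j \<in> S" "own j \<noteq> {}" using t(3,4) ne by blast+
      then show ?thesis
        using ownership_invD(3)[OF inv] t(2,6) unfolding classes_kept_def by metis
    qed
    then show ?thesis using t unfolding ownership_inv_def by blast
  qed
  then show "ownership_inv L (insert i S) own'" "classes_kept L S own own'" by blast+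
  fix M k
  assume inj: "inj_on M (insert i {j\<in>S. own j \<noteq> {}})"
    and M: "\<And>j k. j \<in> S \<Longrightarrow> own j \<noteq> {} \<Longrightarrow> own j \<subseteq> L j k \<Longrightarrow> M j \<in> L j k" and Mi: "M i \<in> L i k"
  have k: "k \<le> card Obj" using valid_pref_le_card[OF val_i Mi] .
  have acc: "M i \<in> acceptable (L i)" using Mi by (auto simp: acceptable_def)
  \<comment> \<open>If \<open>M i\<close> is already owned, Hall's argument makes it tradable, and
    \<open>j2\<close> is the best class with a tradable object.\<close>
  have best: "M i \<in> Oi \<or> j2 \<le> k"
  proof (cases "M i \<in> Oi")
    case False
    then have "M i \<in> (\<Union>h. own h)" using valid_prefD(1)[OF val_i] Mi by (auto simp: Oi_def)
    then have tr: "M i \<in> tradable L own i S"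
      using assignment_tradable[OF inv assms(2,3) val_S inj M acc] by blast
    then obtain a where a: "max_TG R L own i S = Some a"
      using max_TG_None[of L own i S] tr by (cases "max_TG R L own i S") auto
    from max_TG_Some[OF a val_i] show ?thesis using tr Mi a by (auto simp: j2_def)
  qed simp
  show "own' i \<noteq> {} \<and> (\<exists>l\<le>k. own' i \<subseteq> L i l)"
  proof (cases "j1 \<le> j2")
    case True
    then have own': "own' i = Oi \<inter> L i j1" using own'_eq by simp
    have "j1 \<le> k" using best True j1(1) Mi by (meson le_trans)
    \<comment> \<open>\<open>k \<le> card Obj\<close> shows that \<open>j1\<close> is not its
      default value.\<close>
    then have "Oi \<inter> acceptable (L i) \<noteq> {}" using k by (auto simp: j1_def)
    then have "Oi \<inter> L i j1 \<noteq> {}" using j1(2) by (auto simp: acceptable_def)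
    then show ?thesis using own' \<open>j1 \<le> k\<close> by auto
  next
    case False
    then obtain a where a: "max_TG R L own i S = Some a" "a \<in> tradable L own i S" "a \<in> L i j2" "j2 < j1"
      using trade by blast
    then have "own' = trading R pick L i a S own" using own'_eq by simp
    then have "own' i = {a}" using trading_properties(1)[OF inv val_S \<open>i \<notin> S\<close> a(2)] by simp
    moreover have "j2 \<le> k" using best a(4) j1(1) Mi by (meson le_trans less_imp_le)
    ultimately show ?thesis using a(3) by auto
  qed
qed

section \<open>Complete runs\<close>

lemma SDMT2_run_properties:
  assumes "ownership_inv L S own" "finite S" "S \<inter> set xs = {}" "distinct xs"
    and "\<forall>j\<in>S \<union> set xs. valid_pref Obj (L j)"
  shows "ownership_inv L (S \<union> set xs) (SDMT2_run Obj R pick L xs S own) \<and>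
    classes_kept L S own (SDMT2_run Obj R pick L xs S own)"
  using assms
proof (induction xs arbitrary: S own)
  case Nil
  then show ?case by (simp add: classes_kept_def)
next
  case (Cons i xs)
  let ?own = "SDMT2_step Obj R pick L i S own"
  have step: "ownership_inv L (insert i S) ?own" "classes_kept L S own ?own"
    using SDMT2_step_properties(1,2)[of L S own i] Cons.prems by auto
  have "ownership_inv L (insert i S \<union> set xs) (SDMT2_run Obj R pick L xs (insert i S) ?own) \<and>
    classes_kept L (insert i S) ?own (SDMT2_run Obj R pick L xs (insert i S) ?own)"
    using step(1) Cons.prems by (intro Cons.IH) auto
  then show ?case using step(2) classes_kept_trans[of L S own ?own] by (auto simp: classes_kept_def)
qed

text \<open>A step reads the lists of \<open>i\<close> and the agents in \<open>S\<close> only.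
  Besides the graph, a trade uses \<open>wanted\<close> for the agent before the last on the path,
  who is one of these; this is known only if a path exists, hence the restriction to tradable
  objects in the proof.\<close>

lemma SDMT2_step_cong:
  assumes "ownership_inv L S own" "i \<notin> S" "\<forall>j\<in>insert i S. L j = L' j"
    and val: "\<forall>j\<in>insert i S. valid_pref Obj (L j)"
  shows "SDMT2_step Obj R pick L i S own = SDMT2_step Obj R pick L' i S own"
proof -
  have TG: "TG L own i B S = TG L' own i B S" for B using assms(3) by (intro TG_cong) auto
  have Li: "L i = L' i" using assms(3) by simp
  have max: "max_TG R L own i S = max_TG R L' own i S"
    by (simp only: max_TG_def tradable_def TG Li)
  have "trading R pick L i a S own = trading R pick L' i a S own" if "a \<in> tradable L own i S" for a
  proof -
    let ?p = "pick own (TG L own i {a} S) i"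
    have "last (butlast ?p) \<in> insert i S"
      using trading_path_properties(9)[OF assms(1) _ assms(2) picked_path[OF assms(1,2) that]] val
      by blast
    then have "L (last (butlast ?p)) = L' (last (butlast ?p))" using assms(3) by blast
    then have "wanted L own i {a} (last (butlast ?p)) = wanted L' own i {a} (last (butlast ?p))"
      by (simp add: wanted_def)
    then show ?thesis by (simp add: trading_def TG)
  qed
  moreover have "a \<in> tradable L own i S" if "max_TG R L own i S = Some a" for a
    using max_TG_Some[OF that] val by blast
  moreover define A where "A = Obj - (\<Union>j\<in>S. own j)"
  moreover define j1 where "j1 = (if A \<inter> acceptable (L' i) \<noteq> {} then LEAST j. A \<inter> L' i j \<noteq> {} else card Obj + 1)"
  \<comment> \<open>Excludes the branch that would trade with \<open>the None\<close>.\<close>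
  moreover have "j1 \<le> card Obj + 1" unfolding j1_def using val Li by (metis first_class_le insertI1)
  moreover have "SDMT2_step Obj R pick Q i S own =
    (if j1 \<le> (case max_TG R L' own i S of None \<Rightarrow> card Obj + 1 | Some a \<Rightarrow> pref_rank Obj (L' i) a)
     then own(i := A \<inter> L' i j1) else trading R pick Q i (the (max_TG R L' own i S)) S own)"
    if "Q = L \<or> Q = L'" for Q
    using that by (elim disjE; simp only: SDMT2_step_def Let_def max Li A_def j1_def)
  ultimately show ?thesis using max by (cases "max_TG R L' own i S") simp_all
qed

lemma SDMT2_run_cong:
  assumes "ownership_inv L S own" "finite S" "S \<inter> set xs = {}" "distinct xs"
    and "\<forall>j\<in>S \<union> set xs. L j = L' j" "\<forall>j\<in>S \<union> set xs. valid_pref Obj (L j)"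
  shows "SDMT2_run Obj R pick L xs S own = SDMT2_run Obj R pick L' xs S own"
  using assms
proof (induction xs arbitrary: S own)
  case (Cons i xs)
  let ?own = "SDMT2_step Obj R pick L i S own"
  have "ownership_inv L (insert i S) ?own"
    using SDMT2_step_properties(1)[of L S own i] Cons.prems by auto
  then have "SDMT2_run Obj R pick L xs (insert i S) ?own = SDMT2_run Obj R pick L' xs (insert i S) ?own"
    using Cons.prems by (intro Cons.IH) auto
  moreover have "?own = SDMT2_step Obj R pick L' i S own"
    using Cons.prems by (intro SDMT2_step_cong) auto
  ultimately show ?case by simp
qed simp

lemma SDMT2_run_append:
  "SDMT2_run Obj R pick L (xs @ ys) S own =
     SDMT2_run Obj R pick L ys (S \<union> set xs) (SDMT2_run Obj R pick L xs S own)"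
  by (induction xs arbitrary: S own) auto

lemma ownership_inv_empty: "ownership_inv L {} (\<lambda>_. {})"
  by (simp add: ownership_inv_def)

section \<open>The returned matching and truthfulness\<close>

lemma outcome_rank_SDMT2:
  fixes L :: "'o profile"
  assumes "i \<in> set xs"
  defines "own \<equiv> SDMT2_run Obj R pick L xs {} (\<lambda>_. {})"
  shows "outcome_rank Obj C (SDMT2 Obj R pick L xs) i =
    (if own i = {} then card Obj + 1 else pref_rank Obj C (highest R (own i)))"
  using assms by (auto simp: outcome_rank_def SDMT2_def Let_def)

lemma SDMT2_matching:
  assumes "distinct xs" "set xs = {1..n1}" "\<forall>j\<in>set xs. valid_pref Obj (L j)"
  shows "is_matching n1 L (SDMT2 Obj R pick L xs)"
proof -
  define own where "own = SDMT2_run Obj R pick L xs {} (\<lambda>_. {})"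
  have M: "SDMT2 Obj R pick L xs = {(j, highest R (own j)) | j. j \<in> set xs \<and> own j \<noteq> {}}"
    by (simp add: SDMT2_def Let_def own_def)
  have inv: "ownership_inv L (set xs) own"
    using SDMT2_run_properties[OF ownership_inv_empty, of xs L] assms unfolding own_def by simp
  have mem: "highest R (own j) \<in> own j" if "own j \<noteq> {}" for j
    using highest_mem[OF that own_subset[OF inv assms(3)]] .
  have "highest R (own j) \<in> acceptable (L j)" if "own j \<noteq> {}" for j
    using mem[OF that] ownership_invD(3)[OF inv that] unfolding acceptable_def by blast
  moreover have "j = h" if "own j \<noteq> {}" "own h \<noteq> {}" "highest R (own j) = highest R (own h)" for j h
    using mem[OF that(1)] mem[OF that(2)] that(3) ownership_invD(1)[OF inv, of j h] by auto
  ultimately show ?thesis unfolding is_matching_def M single_valued_def using assms(2) by auto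
qed

text \<open>\<open>pre\<close> consists of the agents ahead of \<open>i\<close> under truthful
  reports; they also open the order after the misreport, with \<open>i\<close> somewhere in
  \<open>rest\<close>. The final matching of the second run serves as the competing assignment in
  the step of \<open>i\<close> in the first run.\<close>

lemma SDMT2_truthful:
  assumes dist: "distinct (pre @ i # post)" "distinct (pre @ rest)" and i: "i \<in> set rest"
    and val: "\<forall>j\<in>set (pre @ i # post) \<union> set rest. valid_pref Obj (L j)" "valid_pref Obj C'"
  shows "outcome_rank Obj (L i) (SDMT2 Obj R pick L (pre @ i # post)) i
    \<le> outcome_rank Obj (L i) (SDMT2 Obj R pick (L(i := C')) (pre @ rest)) i"
proof -
  let ?L' = "L(i := C')"
  let ?S = "set pre"
  define own0 where "own0 = SDMT2_run Obj R pick L pre {} (\<lambda>_. {})"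
  define own1 where "own1 = SDMT2_run Obj R pick L (pre @ i # post) {} (\<lambda>_. {})"
  define own2 where "own2 = SDMT2_run Obj R pick ?L' (pre @ rest) {} (\<lambda>_. {})"
  define step where "step = SDMT2_step Obj R pick L i ?S own0"
  have i_pre: "i \<notin> ?S" using dist(1) by simp
  have val': "\<forall>j\<in>set (pre @ rest). valid_pref Obj (?L' j)" using val by auto
  \<comment> \<open>The lists differ at \<open>i\<close> only, who is not in \<open>pre\<close>, so
    both runs reach the same state here.\<close>
  have own0: "own0 = SDMT2_run Obj R pick ?L' pre {} (\<lambda>_. {})"
    unfolding own0_def using dist(1) val i_pre
    by (intro SDMT2_run_cong) (auto simp: ownership_inv_empty)
  have inv0: "ownership_inv L ?S own0"
    using SDMT2_run_properties[OF ownership_inv_empty, of pre L] dist(1) val unfolding own0_def by simp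
  have inv0': "ownership_inv ?L' ?S own0"
    using SDMT2_run_properties[OF ownership_inv_empty, of pre ?L'] dist(2) val' unfolding own0 by simp
  have own1: "own1 = SDMT2_run Obj R pick L post (insert i ?S) step"
    unfolding own1_def step_def own0_def by (simp add: SDMT2_run_append)
  have val_S: "\<forall>j\<in>insert i ?S. valid_pref Obj (L j)" using val by auto
  note stepp = SDMT2_step_properties[OF inv0 _ i_pre val_S, folded step_def, simplified]
  have run1: "ownership_inv L (insert i ?S \<union> set post) own1 \<and> classes_kept L (insert i ?S) step own1"
    unfolding own1 using stepp(1) dist(1) val by (intro SDMT2_run_properties) auto
  have own2: "own2 = SDMT2_run Obj R pick ?L' rest ?S own0"
    unfolding own2_def own0 by (simp add: SDMT2_run_append)
  have run2: "ownership_inv ?L' (?S \<union> set rest) own2" "classes_kept ?L' ?S own0 own2"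
    using SDMT2_run_properties[OF inv0', of rest] dist(2) val' unfolding own2 by auto
  have mem2: "highest R (own2 j) \<in> own2 j" if "own2 j \<noteq> {}" for j
    using highest_mem[OF that own_subset[OF run2(1)]] val' by simp
  let ?M = "\<lambda>j. highest R (own2 j)"
  have rank1: "outcome_rank Obj (L i) (SDMT2 Obj R pick L (pre @ i # post)) i =
      (if own1 i = {} then card Obj + 1 else pref_rank Obj (L i) (highest R (own1 i)))"
    unfolding own1_def by (rule outcome_rank_SDMT2) simp
  have rank2: "outcome_rank Obj (L i) (SDMT2 Obj R pick ?L' (pre @ rest)) i =
      (if own2 i = {} then card Obj + 1 else pref_rank Obj (L i) (?M i))"
    unfolding own2_def using i by (intro outcome_rank_SDMT2) simp
  have mem1: "highest R (own1 i) \<in> own1 i" if "own1 i \<noteq> {}"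
    using highest_mem[OF that own_subset[OF conjunct1[OF run1]]] val by simp
  have val_i: "valid_pref Obj (L i)" using val_S by simp
  show ?thesis
  proof (cases "own2 i \<noteq> {} \<and> ?M i \<in> acceptable (L i)")
    case True
    then obtain k where k: "?M i \<in> L i k" unfolding acceptable_def by blast
    have ne: "own2 j \<noteq> {}" if "j \<in> insert i {j \<in> ?S. own0 j \<noteq> {}}" for j
      using that True run2(2) unfolding classes_kept_def by blast
    have "inj_on ?M (insert i {j \<in> ?S. own0 j \<noteq> {}})"
    proof (rule inj_onI)
      fix j h assume "j \<in> insert i {j \<in> ?S. own0 j \<noteq> {}}" "h \<in> insert i {j \<in> ?S. own0 j \<noteq> {}}"
        and eq: "?M j = ?M h"
      then have "?M j \<in> own2 j" "?M h \<in> own2 h" using ne mem2 by blast+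
      then show "j = h" using eq ownership_invD(1)[OF run2(1), of j h] by auto
    qed
    moreover have "?M j \<in> L j k" if "j \<in> ?S" "own0 j \<noteq> {}" "own0 j \<subseteq> L j k" for j k
    proof -
      \<comment> \<open>The second run keeps classes with respect to \<open>?L'\<close>, which for
        agents in \<open>pre\<close> are the true ones.\<close>
      have "?L' j = L j" using that(1) i_pre by auto
      then have "own2 j \<subseteq> L j k" using run2(2) that unfolding classes_kept_def by metis
      then show ?thesis using mem2 ne that by blast
    qed
    ultimately have "step i \<noteq> {} \<and> (\<exists>l\<le>k. step i \<subseteq> L i l)"
      using k by (intro stepp(3)[of ?M]) auto
    then obtain l where "step i \<noteq> {}" "l \<le> k" "step i \<subseteq> L i l" by blast
    \<comment> \<open>The agents in \<open>post\<close> may change what \<open>i\<close> owns, but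
      not its class.\<close>
    then have "own1 i \<noteq> {}" "own1 i \<subseteq> L i l"
      using run1 unfolding classes_kept_def by blast+
    then have "pref_rank Obj (L i) (highest R (own1 i)) = l"
      using mem1 by (intro pref_rank_eq[OF val_i]) blast
    moreover have "pref_rank Obj (L i) (?M i) = k" using pref_rank_eq[OF val_i k] .
    ultimately show ?thesis
      unfolding rank1 rank2 using True \<open>own1 i \<noteq> {}\<close> \<open>l \<le> k\<close> by simp
  next
    \<comment> \<open>The misreport leaves \<open>i\<close> without an acceptable object, so its
      rank is \<open>card Obj + 1\<close>, the worst possible.\<close>
    case False
    have "pref_rank Obj (L i) x \<le> card Obj + 1" for x
    proof (cases "x \<in> acceptable (L i)")
      case True
      then obtain k where "x \<in> L i k" unfolding acceptable_def by blast
      then show ?thesis using pref_rank_eq[OF val_i] valid_pref_le_card[OF val_i] by fastforce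
    qed (simp add: pref_rank_def)
    then show ?thesis unfolding rank1 rank2 using False by (auto simp: pref_rank_def)
  qed
qed

end

theorem theorem4p5:
  fixes n1 :: nat and Obj :: "'o set" and R :: "'o rel" and pick :: "'o path_rule"
  assumes "finite Obj"
    and "strict_linear_order_on Obj R"
    and "valid_path_rule pick"
  shows "universally_truthful n1 Obj (uniform_draws n1) (random_SDMT2 n1 Obj R pick) \<and>
    (\<forall>Y. (\<forall>j\<in>{1..n1}. Y j \<in> {0..1}) \<longrightarrow>
      (\<forall>W L i w' C'.
        valid_weights n1 W \<longrightarrow> valid_profile n1 Obj L \<longrightarrow> i \<in> {1..n1} \<longrightarrow>
        0 < w' \<longrightarrow> w' \<le> W i \<longrightarrow> valid_pref Obj C' \<longrightarrow>
        outcome_rank Obj (L i) (random_SDMT2 n1 Obj R pick Y W L) i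
          \<le> outcome_rank Obj (L i)
               (random_SDMT2 n1 Obj R pick Y (W(i := w')) (L(i := C'))) i))"
proof -
  interpret house_allocation Obj R pick using assms by unfold_locales
  have rank_le: "outcome_rank Obj (L i) (random_SDMT2 n1 Obj R pick Y W L) i
      \<le> outcome_rank Obj (L i) (random_SDMT2 n1 Obj R pick Y (W(i := w')) (L(i := C'))) i"
    if Y: "\<forall>j\<in>{1..n1}. Y j \<in> {0..1}" and L: "valid_profile n1 Obj L" and i: "i \<in> {1..n1}"
      and w': "w' \<le> W i" and C': "valid_pref Obj C'" for Y W L i w' C'
  proof -
    have "i \<in> set (agent_order n1 Y W)" using i agent_order_properties(2) by blast
    then obtain pre post where xs: "agent_order n1 Y W = pre @ i # post" by (metis split_list)
    obtain rest where ys: "agent_order n1 Y (W(i := w')) = pre @ rest"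
      using agent_order_prefix[OF xs _ w'] Y i by auto
    have dist: "distinct (pre @ i # post)" "distinct (pre @ rest)"
        and sets: "set (pre @ i # post) = {1..n1}" "set (pre @ rest) = {1..n1}"
      using agent_order_properties xs ys by metis+
    have "i \<in> set rest" using dist sets i by auto
    moreover have "\<forall>j\<in>set (pre @ i # post) \<union> set rest. valid_pref Obj (L j)"
      using L sets unfolding valid_profile_def by auto
    ultimately show ?thesis
      unfolding random_SDMT2_def xs ys using SDMT2_truthful dist C' by blast
  qed
  \<comment> \<open>The base measure is restricted to the unit interval, so the bounds hold at every
    sample point and not merely almost surely.\<close>
  have space: "\<forall>j\<in>{1..n1}. Y j \<in> {0..1}" if "Y \<in> space (uniform_draws n1)" for Y
    using that by (auto simp: uniform_draws_def space_PiM space_restrict_space PiE_iff)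
  have "universally_truthful n1 Obj (uniform_draws n1) (random_SDMT2 n1 Obj R pick)"
    unfolding universally_truthful_def
  proof (intro conjI allI impI ballI)
    show "prob_space (uniform_draws n1)" by (rule prob_space_uniform_draws)
    show "(\<lambda>Y. random_SDMT2 n1 Obj R pick Y W L) \<in> uniform_draws n1 \<rightarrow>\<^sub>M count_space UNIV" for W L
      \<comment> \<open>The draws enter only through the order, and every function on a discrete
        space is measurable.\<close>
      unfolding random_SDMT2_def by (rule measurable_compose[OF agent_order_measurable]) simp
    show "is_mechanism n1 Obj (random_SDMT2 n1 Obj R pick Y)" for Y
      unfolding is_mechanism_def random_SDMT2_def
      using SDMT2_matching agent_order_properties by (metis valid_profile_def)
    show "truthful n1 Obj (random_SDMT2 n1 Obj R pick Y)" if "Y \<in> space (uniform_draws n1)" for Y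
      unfolding truthful_def using rank_le[OF space[OF that]] by blast
  qed
  then show ?thesis using rank_le by blast
qed

end
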